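(* Let $V\subseteq\mathbb{R}_+^n$ be a closed max cone, and for each $i\in\{1,\dots,n\}$ let $E_i$ be the set of scaled points of $V$ that are minimal in $V$ with respect to $\leq_i$. Then for every $y\in\mathbb{R}_+^n$ and every $i\in\operatorname{supp}(y)$, $$(P_V(y))_i=\bigoplus_{v\in E_i} (y/v)\, v_i .$$ Moreover, the projector $P_V$ is linear with respect to the componentwise minimum $\wedge$ if and only if every set $E_i$, $i\in\{1,\dots,n\}$, is a singleton.
   Context: $\mathbb{R}_+$ is the set of nonnegative reals and $a\oplus b:=\max(a,b)$, applied componentwise to vectors; $\bigoplus$ denotes maximum (equal to $0$ over an empty index set). A max cone is a subset of $\mathbb{R}_+^n$ closed under componentwise maximum and under multiplication by nonnegative scalars; closed means topologically closed. For a closed max cone $V$, the nonlinear projector is $P_V(y)=\max\{v\in V\mid v\leq y\}$ for $y\in\mathbb{R}_+^n$ (the greatest element of this set, which exists). For $v\in\mathbb{R}_+^n$, $\operatorname{supp}(v)=\{i\mid v_i\neq 0\}$. For $v\neq 0$, $y/v:=\min_{i\in\operatorname{supp}(v)} y_i v_i^{-1}=\max\{\lambda\mid\lambda v\leq y\}$. The preorder $\leq_j$ is defined by: $u\leq_j v$ if and only if $u_j\neq0$, $v_j\neq 0$ and $u u_j^{-1}\leq v v_j^{-1}$ componentwise. A vector $v\in V$ with $v_j\neq 0$ is minimal in $V$ with respect to $\leq_j$ if $u\in V$, $u\leq_j v$ imply that $u$ and $v$ are proportional (equivalently $v\leq_j u$). A vector $v$ is scaled if $\|v\|=1$ for a fixed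 norm (e.g. the Euclidean norm or the max norm). $P_V$ is linear with respect to $\wedge$ if $P_V(\lambda x\wedge\mu y)=\lambda P_V(x)\wedge\mu P_V(y)$ for all $x,y\in\mathbb{R}_+^n$ and $\lambda,\mu\in\mathbb{R}_+$, where $\wedge$ is the componentwise minimum.
   Formalization: The singleton condition in the equivalence is required only for those i for which some v in V has v_i ≠ 0; otherwise E_i is empty and the claim fails, e.g. V={(a,0)} in R_+^2 has a ∧-linear projector but E_2 is empty. *)

theory Defs
  imports "HOL-Analysis.Analysis"
begin

text \<open>
  Vectors live in \<open>real ^ 'n\<close>; \<open>\<le>\<close>, \<open>sup\<close> and \<open>inf\<close> on this type are the componentwise
  order, maximum and minimum.
\<close>

text \<open>Nonemptiness is part of the notion: it gives \<open>0 \<in> V\<close>, without which the projector is undefined.\<close>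

definition max_cone :: "(real ^ 'n) set \<Rightarrow> bool" where
  "max_cone V \<longleftrightarrow> V \<noteq> {} \<and> V \<subseteq> {v. 0 \<le> v} \<and>
     (\<forall>u\<in>V. \<forall>v\<in>V. sup u v \<in> V) \<and> (\<forall>c\<ge>0. \<forall>v\<in>V. c *\<^sub>R v \<in> V)"

definition projector :: "(real ^ 'n) set \<Rightarrow> real ^ 'n \<Rightarrow> real ^ 'n" where
  "projector V y = (GREATEST v. v \<in> V \<and> v \<le> y)"

definition supp :: "real ^ 'n \<Rightarrow> 'n set" where
  "supp v = {i. v $ i \<noteq> 0}"

text \<open>The residual \<open>y / v\<close>, meaningful for \<open>v \<noteq> 0\<close>.\<close>

definition residual :: "real ^ 'n \<Rightarrow> real ^ 'n \<Rightarrow> real" where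
  "residual y v = Min ((\<lambda>i. y $ i * inverse (v $ i)) ` supp v)"

definition le_at :: "'n \<Rightarrow> real ^ 'n \<Rightarrow> real ^ 'n \<Rightarrow> bool" where
  "le_at j u v \<longleftrightarrow> u $ j \<noteq> 0 \<and> v $ j \<noteq> 0 \<and>
     inverse (u $ j) *\<^sub>R u \<le> inverse (v $ j) *\<^sub>R v"

definition proportional :: "real ^ 'n \<Rightarrow> real ^ 'n \<Rightarrow> bool" where
  "proportional u v \<longleftrightarrow> (\<exists>c>0. u = c *\<^sub>R v)"

definition minimal_at :: "(real ^ 'n) set \<Rightarrow> 'n \<Rightarrow> real ^ 'n \<Rightarrow> bool" where
  "minimal_at V j v \<longleftrightarrow> v \<in> V \<and> v $ j \<noteq> 0 \<and>
     (\<forall>u\<in>V. le_at j u v \<longrightarrow> proportional u v)"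

text \<open>An arbitrary norm on the vector space, not necessarily the Euclidean norm of the type class.\<close>

definition is_norm :: "(real ^ 'n \<Rightarrow> real) \<Rightarrow> bool" where
  "is_norm N \<longleftrightarrow> (\<forall>x. 0 \<le> N x) \<and> (\<forall>x. N x = 0 \<longleftrightarrow> x = 0) \<and>
     (\<forall>c x. N (c *\<^sub>R x) = \<bar>c\<bar> * N x) \<and> (\<forall>x y. N (x + y) \<le> N x + N y)"

definition scaled_minimal ::
    "(real ^ 'n \<Rightarrow> real) \<Rightarrow> (real ^ 'n) set \<Rightarrow> 'n \<Rightarrow> (real ^ 'n) set" where
  "scaled_minimal N V i = {v. minimal_at V i v \<and> N v = 1}"

text \<open>
  \<open>is_bigoplus A f m\<close>: the number \<open>m\<close> is \<open>\<Oplus>v\<in>A. f v\<close>. The index set may be infinite, so this is a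
  relation which also asserts that the maximum exists, i.e. is attained; it is \<open>0\<close> over the empty set.
\<close>

definition is_bigoplus :: "'a set \<Rightarrow> ('a \<Rightarrow> real) \<Rightarrow> real \<Rightarrow> bool" where
  "is_bigoplus A f m \<longleftrightarrow>
     (if A = {} then m = 0 else (\<exists>v\<in>A. f v = m) \<and> (\<forall>v\<in>A. f v \<le> m))"

definition min_linear :: "(real ^ 'n \<Rightarrow> real ^ 'n) \<Rightarrow> bool" where
  "min_linear P \<longleftrightarrow>
     (\<forall>x y. \<forall>a b. 0 \<le> x \<and> 0 \<le> y \<and> 0 \<le> a \<and> 0 \<le> b \<longrightarrow>
        P (inf (a *\<^sub>R x) (b *\<^sub>R y)) = inf (a *\<^sub>R P x) (b *\<^sub>R P y))"

end

theory Submission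
  imports Defs
begin

text \<open>
  Everything rests on two compactness arguments, both of which optimise the coordinate sum,
  a continuous function that is strictly monotone for the componentwise order. Maximising it over
  the points of \<open>V\<close> below \<open>y\<close> gives the projection: the supremum of a maximiser with any other
  competitor is again a competitor, hence equals the maximiser. Minimising it over the points of
  \<open>V\<close> below \<open>p\<close> whose \<open>i\<close>-th coordinate is still \<open>p\<^sub>i > 0\<close> gives a point that is minimal for
  \<open>\<le>\<^sub>i\<close> (lemma \<open>minimal_at_below\<close>).

  For the formula, every multiple \<open>(y / v) v\<close> with \<open>0 \<noteq> v \<in> V\<close> lies in \<open>V\<close> and below \<open>y\<close>, hence below
  \<open>p = P y\<close>; and when \<open>p\<^sub>i > 0\<close>, a minimal point below \<open>p\<close> that agrees with \<open>p\<close> at \<open>i\<close> attains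
  the value \<open>p\<^sub>i\<close> after rescaling.

  If \<open>E\<^sub>i = {v}\<close>, the formula becomes \<open>(P y)\<^sub>i = (y / v) v\<^sub>i\<close>, and \<open>y \<mapsto> y / v\<close> is linear for
  \<open>\<and>\<close> because it is a minimum of scaled coordinates. Conversely, a projector that preserves
  \<open>\<and>\<close> makes \<open>V\<close>, its set of fixed points, closed under \<open>\<and>\<close>. Two points minimal for \<open>\<le>\<^sub>i\<close>
  and normalised to have \<open>i\<close>-th coordinate \<open>1\<close> then have their infimum in \<open>V\<close> with the same
  \<open>i\<close>-th coordinate, so minimality forces both to coincide with it.
\<close>

section \<open>Optimising the coordinate sum\<close>

lemma coordinate_sum_mono:
  fixes u v :: "real ^ 'n"
  assumes "u \<le> v"
  shows "(\<Sum>k\<in>UNIV. u $ k) \<le> (\<Sum>k\<in>UNIV. v $ k)"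
  using assms by (intro sum_mono) (simp add: less_eq_vec_def)

lemma eq_if_le_and_coordinate_sum_ge:
  fixes u v :: "real ^ 'n"
  assumes "u \<le> v" and "(\<Sum>k\<in>UNIV. v $ k) \<le> (\<Sum>k\<in>UNIV. u $ k)"
  shows "u = v"
proof -
  have "(\<Sum>k\<in>UNIV. v $ k - u $ k) = 0"
    using assms(2) coordinate_sum_mono[OF assms(1)] by (simp add: sum_subtractf)
  then have "v $ k - u $ k = 0" for k
    using assms(1) by (subst (asm) sum_nonneg_eq_0_iff) (auto simp: less_eq_vec_def)
  then show ?thesis
    by (simp add: vec_eq_iff)
qed

lemma continuous_on_coordinate_sum:
  "continuous_on S (\<lambda>v :: real ^ 'n. \<Sum>k\<in>UNIV. v $ k)"
  by (intro continuous_intros)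

lemma max_cone_nonneg: "max_cone V \<Longrightarrow> v \<in> V \<Longrightarrow> 0 \<le> v"
  and max_cone_sup: "max_cone V \<Longrightarrow> u \<in> V \<Longrightarrow> v \<in> V \<Longrightarrow> sup u v \<in> V"
  and max_cone_scale: "max_cone V \<Longrightarrow> 0 \<le> c \<Longrightarrow> v \<in> V \<Longrightarrow> c *\<^sub>R v \<in> V"
  by (auto simp: max_cone_def)

lemma coordinate_pos:
  fixes v :: "real ^ 'n"
  assumes "0 \<le> v" and "v $ i \<noteq> 0"
  shows "0 < v $ i"
  using assms by (metis less_eq_vec_def zero_index order_less_le)

lemma max_cone_zero: "max_cone V \<Longrightarrow> 0 \<in> V"
  using max_cone_scale[of V 0] by (auto simp: max_cone_def)

lemma compact_max_cone_below:
  assumes "max_cone V" and "closed V"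
  shows "compact {v \<in> V. v \<le> y}"
proof -
  have "{v \<in> V. v \<le> y} = V \<inter> {0..y}"
    using max_cone_nonneg[OF assms(1)] by auto
  then show ?thesis
    using assms(2) by (simp add: closed_Int_compact)
qed

section \<open>The projector\<close>

lemma greatest_max_cone_below:
  assumes "max_cone V" and "closed V" and "0 \<le> y"
  obtains p where "p \<in> V" and "p \<le> y" and "\<And>v. v \<in> V \<Longrightarrow> v \<le> y \<Longrightarrow> v \<le> p"
proof -
  let ?S = "{v \<in> V. v \<le> y}"
  have "?S \<noteq> {}"
    using max_cone_zero[OF assms(1)] assms(3) by auto
  then obtain p where p: "p \<in> ?S"
    and max: "\<And>v. v \<in> ?S \<Longrightarrow> (\<Sum>k\<in>UNIV. v $ k) \<le> (\<Sum>k\<in>UNIV. p $ k)"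
    using continuous_attains_sup[OF compact_max_cone_below[OF assms(1,2)] _
        continuous_on_coordinate_sum] by blast
  have "v \<le> p" if "v \<in> V" "v \<le> y" for v
  proof -
    have "sup p v \<in> ?S"
      using p that max_cone_sup[OF assms(1)] by auto
    then have "p = sup p v"
      by (intro eq_if_le_and_coordinate_sum_ge max) simp_all
    then show ?thesis
      by (metis sup.cobounded2)
  qed
  with p that show ?thesis by blast
qed

lemma
  assumes "max_cone V" and "closed V" and "0 \<le> y"
  shows projector_in: "projector V y \<in> V"
    and projector_le: "projector V y \<le> y"
    and projector_greatest: "\<And>v. v \<in> V \<Longrightarrow> v \<le> y \<Longrightarrow> v \<le> projector V y"
proof -
  obtain p where p: "p \<in> V" "p \<le> y" "\<And>v. v \<in> V \<Longrightarrow> v \<le> y \<Longrightarrow> v \<le> p"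
    using greatest_max_cone_below[OF assms] by blast
  then have "projector V y = p"
    unfolding projector_def by (intro Greatest_equality) auto
  with p show "projector V y \<in> V" "projector V y \<le> y"
    "\<And>v. v \<in> V \<Longrightarrow> v \<le> y \<Longrightarrow> v \<le> projector V y"
    by auto
qed

lemma projector_fixed:
  assumes "max_cone V" and "closed V" and "v \<in> V"
  shows "projector V v = v"
  using assms max_cone_nonneg[OF assms(1,3)]
  by (intro antisym projector_le projector_greatest) auto

section \<open>Minimal points\<close>

text \<open>
  A minimiser \<open>w\<close> of the coordinate sum works: a point \<open>u \<le>\<^sub>i w\<close>, rescaled to agree with \<open>w\<close>
  at \<open>i\<close>, is itself a competitor below \<open>w\<close>, hence equal to \<open>w\<close>.
\<close>

lemma minimal_at_below:
  assumes "max_cone V" and "closed V" and "p \<in> V" and "p $ i \<noteq> 0"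
  obtains w where "minimal_at V i w" and "w \<le> p" and "w $ i = p $ i"
proof -
  let ?S = "{v \<in> V. v \<le> p} \<inter> {v. v $ i = p $ i}"
  have compact: "compact ?S"
    by (intro compact_Int_closed compact_max_cone_below assms(1,2)
        closed_Collect_eq continuous_intros)
  have nonempty: "?S \<noteq> {}"
    using assms(3) by auto
  obtain w where w: "w \<in> ?S"
    and min: "\<And>v. v \<in> ?S \<Longrightarrow> (\<Sum>k\<in>UNIV. w $ k) \<le> (\<Sum>k\<in>UNIV. v $ k)"
    using continuous_attains_inf[OF compact nonempty continuous_on_coordinate_sum] by blast
  have w0: "w $ i > 0"
    using w assms(4) max_cone_nonneg[OF assms(1), of w] by (intro coordinate_pos) auto
  have "proportional u w" if u: "u \<in> V" and le: "le_at i u w" for u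
  proof -
    have u0: "u $ i > 0"
      using le max_cone_nonneg[OF assms(1) u] by (intro coordinate_pos) (auto simp: le_at_def)
    let ?c = "w $ i / u $ i"
    have "?c *\<^sub>R u = w $ i *\<^sub>R inverse (u $ i) *\<^sub>R u"
      by (simp add: divide_inverse)
    also have "\<dots> \<le> w $ i *\<^sub>R inverse (w $ i) *\<^sub>R w"
      using le w0 by (intro scaleR_left_mono) (auto simp: le_at_def)
    finally have cu: "?c *\<^sub>R u \<le> w"
      using w0 by simp
    have "?c *\<^sub>R u \<in> ?S"
      using w cu u0 w0 max_cone_scale[OF assms(1) _ u, of ?c] by auto
    then have "?c *\<^sub>R u = w"
      by (intro eq_if_le_and_coordinate_sum_ge cu min)
    then have "inverse ?c *\<^sub>R ?c *\<^sub>R u = inverse ?c *\<^sub>R w"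
      by (rule arg_cong)
    then have "u = inverse ?c *\<^sub>R w"
      using u0 w0 by simp
    then show ?thesis
      unfolding proportional_def using u0 w0 by (intro exI[of _ "inverse ?c"]) simp
  qed
  then have "minimal_at V i w"
    using w w0 by (auto simp: minimal_at_def)
  with w that show ?thesis by blast
qed

lemma minimal_at_scale:
  assumes "max_cone V" and "minimal_at V i w" and "0 < c"
  shows "minimal_at V i (c *\<^sub>R w)"
proof -
  have "proportional u (c *\<^sub>R w)" if "u \<in> V" "le_at i u (c *\<^sub>R w)" for u
  proof -
    have "inverse ((c *\<^sub>R w) $ i) *\<^sub>R c *\<^sub>R w = inverse (w $ i) *\<^sub>R w"
      using assms(3) by (simp add: vec_eq_iff)
    then have "le_at i u w"
      using that(2) unfolding le_at_def by (metis mult_eq_0_iff vector_scaleR_component real_scaleR_def)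
    then have "proportional u w"
      using assms(2) that(1) by (simp add: minimal_at_def)
    then obtain d where "d > 0" "u = d *\<^sub>R w"
      by (auto simp: proportional_def)
    then show ?thesis
      unfolding proportional_def using assms(3) by (intro exI[of _ "d / c"]) simp
  qed
  then show ?thesis
    using assms max_cone_scale[OF assms(1), of c w] by (auto simp: minimal_at_def)
qed

lemma norm_pos_iff_nonzero: "is_norm N \<Longrightarrow> 0 < N x \<longleftrightarrow> x \<noteq> 0"
  by (metis is_norm_def less_le)

lemma norm_scale: "is_norm N \<Longrightarrow> N (c *\<^sub>R x) = \<bar>c\<bar> * N x"
  by (simp add: is_norm_def)

lemma scaled_minimal_normalise:
  assumes "max_cone V" and "is_norm N" and "minimal_at V i w"
  shows "0 < N w" and "inverse (N w) *\<^sub>R w \<in> scaled_minimal N V i"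
proof -
  have "w \<noteq> 0"
    using assms(3) by (auto simp: minimal_at_def)
  then show N: "0 < N w"
    using norm_pos_iff_nonzero[OF assms(2)] by simp
  then show "inverse (N w) *\<^sub>R w \<in> scaled_minimal N V i"
    using minimal_at_scale[OF assms(1,3), of "inverse (N w)"]
    by (simp add: scaled_minimal_def norm_scale[OF assms(2)])
qed

lemma scaled_minimal_nonempty:
  assumes "max_cone V" and "closed V" and "is_norm N" and "p \<in> V" and "p $ i \<noteq> 0"
  shows "scaled_minimal N V i \<noteq> {}"
proof -
  obtain w where "minimal_at V i w"
    using minimal_at_below[OF assms(1,2,4,5)] .
  then show ?thesis
    using scaled_minimal_normalise[OF assms(1,3)] by blast
qed

section \<open>The residual\<close>

text \<open>
  This Galois connection replaces the minimum in all later arguments. Coordinates outside the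
  support of \<open>v\<close> impose no condition on \<open>c\<close>, because \<open>y\<close> is nonnegative there.
\<close>

lemma le_residual_iff:
  assumes "0 \<le> v" and "v $ i \<noteq> 0" and "0 \<le> y"
  shows "c \<le> residual y v \<longleftrightarrow> c *\<^sub>R v \<le> y"
proof -
  have "c \<le> residual y v \<longleftrightarrow> (\<forall>k\<in>supp v. c \<le> y $ k * inverse (v $ k))"
    unfolding residual_def using assms(2) by (subst Min_ge_iff) (auto simp: supp_def)
  also have "\<dots> \<longleftrightarrow> (\<forall>k. c * v $ k \<le> y $ k)"
  proof (intro iffI allI ballI)
    fix k assume *: "\<forall>k\<in>supp v. c \<le> y $ k * inverse (v $ k)"
    show "c * v $ k \<le> y $ k"
    proof (cases "v $ k = 0")
      case True
      then show ?thesis using assms(3) by (simp add: less_eq_vec_def)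
    next
      case False
      then have "v $ k > 0" using assms(1) by (rule coordinate_pos[rotated])
      moreover have "c \<le> y $ k / v $ k" using * False by (simp add: supp_def divide_inverse)
      ultimately show ?thesis by (simp add: pos_le_divide_eq)
    qed
  next
    fix k assume *: "\<forall>k. c * v $ k \<le> y $ k" and "k \<in> supp v"
    then have "v $ k > 0" using assms(1) by (simp add: coordinate_pos supp_def)
    then show "c \<le> y $ k * inverse (v $ k)" using * by (auto simp: field_simps)
  qed
  also have "\<dots> \<longleftrightarrow> c *\<^sub>R v \<le> y"
    by (simp add: less_eq_vec_def)
  finally show ?thesis .
qed

lemma residual_nonneg:
  assumes "0 \<le> v" and "v $ i \<noteq> 0" and "0 \<le> y"
  shows "0 \<le> residual y v"
  using le_residual_iff[OF assms, of 0] assms(3) by simp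

lemma residual_scale_le:
  assumes "0 \<le> v" and "v $ i \<noteq> 0" and "0 \<le> y"
  shows "residual y v *\<^sub>R v \<le> y"
  using le_residual_iff[OF assms] by blast

lemma residual_inf:
  assumes "0 \<le> v" and "v $ i \<noteq> 0" and "0 \<le> x" and "0 \<le> y"
  shows "residual (inf x y) v = min (residual x v) (residual y v)"
proof -
  have "c \<le> residual (inf x y) v \<longleftrightarrow> c \<le> min (residual x v) (residual y v)" for c
    using assms by (simp add: le_residual_iff[OF assms(1,2)])
  then show ?thesis
    by (meson antisym order_refl)
qed

lemma residual_scale:
  assumes "v $ i \<noteq> 0" and "0 \<le> a"
  shows "residual (a *\<^sub>R y) v = a * residual y v"
proof -
  have "mono ((*) a)"
    using assms(2) by (auto simp: mono_def mult_left_mono)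
  then have "a * residual y v = Min ((*) a ` (\<lambda>k. y $ k * inverse (v $ k)) ` supp v)"
    unfolding residual_def using assms(1) by (intro mono_Min_commute) (auto simp: supp_def)
  then show ?thesis
    by (simp add: residual_def image_image mult.assoc)
qed

section \<open>The projector as a maximum over minimal points\<close>

lemma residual_le_projector:
  assumes "max_cone V" and "closed V" and "0 \<le> y" and "v \<in> V" and "v $ i \<noteq> 0"
  shows "residual y v * v $ i \<le> projector V y $ i"
proof -
  note v = max_cone_nonneg[OF assms(1,4)] assms(5,3)
  have "residual y v *\<^sub>R v \<le> projector V y"
    using projector_greatest[OF assms(1-3)] max_cone_scale[OF assms(1) residual_nonneg[OF v] assms(4)]
      residual_scale_le[OF v] by blast
  then show ?thesis
    by (simp add: less_eq_vec_def)
qed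

text \<open>
  Each term is at most \<open>(P y)\<^sub>i\<close>, so only attainment is at stake. If \<open>(P y)\<^sub>i = 0\<close>, the terms are
  squeezed between \<open>0\<close> and \<open>0\<close>. Otherwise a minimal point \<open>w \<le> P y\<close> with \<open>w\<^sub>i = (P y)\<^sub>i\<close> gives
  the maximiser after normalisation, since \<open>w \<le> y\<close> means that the normalised point can be
  multiplied by at least \<open>N w\<close> without leaving the region below \<open>y\<close>. In particular \<open>E\<^sub>i\<close> is
  nonempty in that case, so the convention for an empty maximum applies only when \<open>(P y)\<^sub>i = 0\<close>.
\<close>

lemma projector_eq_bigoplus:
  assumes "max_cone V" and "closed V" and "is_norm N" and "0 \<le> y"
  shows "is_bigoplus (scaled_minimal N V i) (\<lambda>v. residual y v * v $ i) (projector V y $ i)"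
proof -
  let ?E = "scaled_minimal N V i" and ?p = "projector V y"
  have p: "?p \<in> V" "?p \<le> y"
    using projector_in projector_le assms by blast+
  have E: "v \<in> V" "v $ i \<noteq> 0" if "v \<in> ?E" for v
    using that by (auto simp: scaled_minimal_def minimal_at_def)
  then have upper: "residual y v * v $ i \<le> ?p $ i" if "v \<in> ?E" for v
    using that by (intro residual_le_projector assms)
  have attained: "\<exists>v\<in>?E. residual y v * v $ i = ?p $ i" if nonempty: "?E \<noteq> {}"
  proof (cases "?p $ i = 0")
    case True
    obtain v where v: "v \<in> ?E"
      using nonempty by blast
    have "0 \<le> v"
      using max_cone_nonneg[OF assms(1)] E[OF v] by blast
    then have "0 \<le> residual y v * v $ i"
      using residual_nonneg[OF _ E(2)[OF v] assms(4)] by (simp add: less_eq_vec_def)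
    then show ?thesis
      using upper[OF v] True v by force
  next
    case False
    obtain w where w: "minimal_at V i w" "w \<le> ?p" "w $ i = ?p $ i"
      using minimal_at_below[OF assms(1,2) p(1) False] .
    let ?v = "inverse (N w) *\<^sub>R w"
    note N = scaled_minimal_normalise[OF assms(1,3) w(1)]
    have v: "0 \<le> ?v"
      using max_cone_nonneg[OF assms(1)] E(1)[OF N(2)] by blast
    have "N w *\<^sub>R ?v \<le> y"
      using w(2) p(2) N(1) by simp
    then have "N w \<le> residual y ?v"
      using le_residual_iff[OF v E(2)[OF N(2)] assms(4)] by blast
    then have "N w * ?v $ i \<le> residual y ?v * ?v $ i"
      using v by (intro mult_right_mono) (auto simp only: less_eq_vec_def zero_index)
    then have "?p $ i \<le> residual y ?v * ?v $ i"
      using w(3) N(1) by (simp add: field_simps)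
    then show ?thesis
      using N(2) upper by (blast intro: antisym)
  qed
  show ?thesis
  proof (cases "?E = {}")
    case True
    then have "?p $ i = 0"
      using scaled_minimal_nonempty[OF assms(1-3) p(1)] by blast
    with True show ?thesis
      by (simp add: is_bigoplus_def)
  next
    case False
    with attained upper show ?thesis
      by (simp add: is_bigoplus_def)
  qed
qed

section \<open>Linearity with respect to the minimum\<close>

text \<open>
  The identity is checked coordinate by coordinate. At a coordinate where all of \<open>V\<close> vanishes, so
  does every projection; elsewhere \<open>(P u)\<^sub>i\<close> is the residual of \<open>u\<close> by one fixed vector.
\<close>

lemma min_linear_if_singletons:
  assumes "max_cone V" and "closed V" and "is_norm N"
    and single: "\<And>i. \<exists>v\<in>V. v $ i \<noteq> 0 \<Longrightarrow> is_singleton (scaled_minimal N V i)"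
  shows "min_linear (projector V)"
  unfolding min_linear_def
proof (intro allI impI, elim conjE)
  fix x y :: "real ^ 'a" and a b :: real
  assume nn: "0 \<le> x" "0 \<le> y" "0 \<le> a" "0 \<le> b"
  let ?z = "inf (a *\<^sub>R x) (b *\<^sub>R y)"
  have ax: "0 \<le> a *\<^sub>R x" "0 \<le> b *\<^sub>R y"
    using nn by (simp_all add: scaleR_nonneg_nonneg)
  then have z: "0 \<le> ?z"
    by simp
  have "projector V ?z $ i = min (a * projector V x $ i) (b * projector V y $ i)" for i
  proof (cases "\<exists>v\<in>V. v $ i \<noteq> 0")
    case False
    then show ?thesis
      using projector_in[OF assms(1,2)] nn z by simp
  next
    case True
    then obtain v where Ev: "scaled_minimal N V i = {v}"
      using single by (auto simp: is_singleton_def)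
    then have v: "v \<in> V" "v $ i \<noteq> 0"
      by (auto simp: scaled_minimal_def minimal_at_def)
    note v0 = max_cone_nonneg[OF assms(1) v(1)]
    have P: "projector V u $ i = residual u v * v $ i" if "0 \<le> u" for u
      using projector_eq_bigoplus[OF assms(1-3) that, of i] by (simp add: Ev is_bigoplus_def)
    have "residual ?z v = min (a * residual x v) (b * residual y v)"
      using residual_inf[OF v0 v(2) ax] residual_scale[OF v(2)] nn by simp
    moreover have "0 \<le> v $ i"
      using v0 by (simp add: less_eq_vec_def)
    ultimately show ?thesis
      using nn z by (simp add: P min_mult_distrib_right mult.assoc)
  qed
  then show "projector V ?z = inf (a *\<^sub>R projector V x) (b *\<^sub>R projector V y)"
    by (simp add: vec_eq_iff inf_vec_def inf_min)
qed

text \<open>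
  Points of \<open>V\<close> are fixed by the projector, so linearity makes their infimum a value of the
  projector.
\<close>

lemma inf_closed_if_min_linear:
  assumes "max_cone V" and "closed V" and "min_linear (projector V)" and "u \<in> V" and "v \<in> V"
  shows "inf u v \<in> V"
proof -
  have nn: "0 \<le> u" "0 \<le> v"
    using max_cone_nonneg assms by blast+
  have "projector V (inf (1 *\<^sub>R u) (1 *\<^sub>R v)) = inf (1 *\<^sub>R projector V u) (1 *\<^sub>R projector V v)"
    using assms(3) nn zero_le_one unfolding min_linear_def by blast
  then have "projector V (inf u v) = inf u v"
    using projector_fixed[OF assms(1,2)] assms(4,5) by simp
  moreover have "projector V (inf u v) \<in> V"
    using nn by (intro projector_in assms) simp
  ultimately show ?thesis
    by simp
qed

lemma minimal_at_normalised_le: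
  assumes "minimal_at V i v" and "v $ i = 1" and "u \<in> V" and "u $ i = 1" and "u \<le> v"
  shows "u = v"
proof -
  have "proportional u v"
    using assms by (auto simp: minimal_at_def le_at_def)
  then show ?thesis
    using assms(2,4) by (auto simp: proportional_def)
qed

text \<open>
  Two minimal points are compared after normalising their \<open>i\<close>-th coordinates to \<open>1\<close>, where
  \<open>\<le>\<^sub>i\<close> becomes the componentwise order and their infimum lies below both; having norm \<open>1\<close>
  then removes the remaining scalar factor.
\<close>

lemma singleton_if_min_linear:
  assumes "max_cone V" and "closed V" and "is_norm N"
    and lin: "min_linear (projector V)" and ex: "\<exists>v\<in>V. v $ i \<noteq> 0"
  shows "is_singleton (scaled_minimal N V i)"
proof (rule is_singletonI')
  show "scaled_minimal N V i \<noteq> {}"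
    using ex scaled_minimal_nonempty[OF assms(1-3)] by blast
next
  fix u v assume uv: "u \<in> scaled_minimal N V i" "v \<in> scaled_minimal N V i"
  then have min: "minimal_at V i u" "minimal_at V i v" and N: "N u = 1" "N v = 1"
    by (auto simp: scaled_minimal_def)
  then have "u \<in> V" "v \<in> V" "u $ i \<noteq> 0" "v $ i \<noteq> 0"
    by (auto simp: minimal_at_def)
  then have pos: "u $ i > 0" "v $ i > 0"
    using max_cone_nonneg[OF assms(1)] by (simp_all add: coordinate_pos)
  let ?u = "inverse (u $ i) *\<^sub>R u" and ?v = "inverse (v $ i) *\<^sub>R v"
  have min': "minimal_at V i ?u" "minimal_at V i ?v"
    using min pos by (auto intro: minimal_at_scale[OF assms(1)])
  have one: "?u $ i = 1" "?v $ i = 1"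
    using pos by simp_all
  have "inf ?u ?v \<in> V"
    using min' by (intro inf_closed_if_min_linear assms) (auto simp: minimal_at_def)
  moreover have "inf ?u ?v $ i = 1"
    using one by (simp add: inf_vec_def)
  ultimately have "inf ?u ?v = ?u" "inf ?u ?v = ?v"
    using minimal_at_normalised_le[OF min'(1) one(1)] minimal_at_normalised_le[OF min'(2) one(2)]
    by simp_all
  then have eq: "?u = ?v"
    by simp
  have "inverse (u $ i) = N ?u" "inverse (v $ i) = N ?v"
    using pos N by (simp_all add: norm_scale[OF assms(3)])
  then have "u $ i = v $ i"
    using eq by (metis inverse_eq_iff_eq)
  with eq pos show "u = v"
    by simp
qed

theorem theorem2p7:
  fixes V :: "(real ^ 'n) set" and N :: "real ^ 'n \<Rightarrow> real"
  assumes "max_cone V" and "closed V" and "is_norm N"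
  shows "(\<forall>y i. 0 \<le> y \<and> i \<in> supp y \<longrightarrow>
            is_bigoplus (scaled_minimal N V i) (\<lambda>v. residual y v * v $ i) (projector V y $ i))
       \<and> (min_linear (projector V) \<longleftrightarrow>
            (\<forall>i. (\<exists>v\<in>V. v $ i \<noteq> 0) \<longrightarrow> is_singleton (scaled_minimal N V i)))"
  using projector_eq_bigoplus[OF assms] min_linear_if_singletons[OF assms]
    singleton_if_min_linear[OF assms] by blast

end
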